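(* Let an $N$-player linear-quadratic generalized Nash game with shared affine constraints be given as in the context, with pseudogradient $\phi(x)=Fx+f$. Let $F+F^\top\succeq 0$, let $F$ be invertible, and, when $q>0$, assume $\operatorname{rank}(E)=q$ and that $M=EF^{-1}E^\top$ is invertible. Then the v-GNE problem of the game can be reformulated as the following convex quadratic program in $\lambda\in\mathbb{R}^m$: $$ \min_{\lambda}\ \lambda^\top H_s\lambda+q_0^\top\lambda\qquad\text{s.t.}\quad H\lambda+q_0\ge 0,\quad \lambda\ge 0, $$ where $H_s=(H+H^\top)/2$ and $H$ and $q_0$ are defined as $$ \begin{aligned} &H=APA^\top,\qquad P=G-GE^\top M^{-1}EG,\qquad G=F^{-1},\\ &q_0=b-Ax_0,\qquad x_0=-Pf+GE^\top M^{-1}e. \end{aligned} $$ The v-GNE $x^\star$ of the game and the associated dual vector $\nu^\star$ can be recovered from the optimal solution $\lambda^\star$ of this quadratic program as $$ x^\star=x_0-PA^\top\lambda^\star,\qquad \nu^\star=-M^{-1}\bigl(EG(f+A^\top\lambda^\star)+e\bigr). $$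
   Context: Game. There are $N$ players; player $i\in\{1,\dots,N\}$ chooses $x_i\in\mathbb{R}^{n_i}$, and $x=(x_1,\dots,x_N)\in\mathbb{R}^n$, $n=\sum_i n_i$. Player $i$ minimizes over $x_i$ the cost $J_i(x)=\tfrac12 x^\top Q^{(i)}x+(c^{(i)})^\top x$, with $Q^{(i)}\in\mathbb{R}^{n\times n}$ symmetric and $c^{(i)}\in\mathbb{R}^n$, subject to the shared constraint $x\in\mathcal{X}=\{x\in\mathbb{R}^n: Ax\le b,\ Ex=e\}$, where $A\in\mathbb{R}^{m\times n}$, $b\in\mathbb{R}^m$, $E\in\mathbb{R}^{q\times n}$, $e\in\mathbb{R}^q$, $m,q\ge 0$. Vector inequalities are componentwise, and $\succeq 0$ means positive semidefinite. Pseudogradient. $\phi(x)=Fx+f$ is obtained by stacking the gradients $\nabla_{x_i}J_i(x)$, i.e. the $i$-th block of rows of $F\in\mathbb{R}^{n\times n}$ (the $n_i$ rows indexed by the coordinates of $x_i$) equals the $i$-th block of rows of $Q^{(i)}$, and the $i$-th block of $f\in\mathbb{R}^n$ equals the $i$-th block of $c^{(i)}$. v-GNE. A variational generalized Nash equilibrium (v-GNE) is a point $x^\star\in\mathcal{X}$ with $\phi(x^\star)^\top(y-x^\star)\ge 0$ for all $y\in\mathcal{X}$; the v-GNE problem is the problem of computing such a point. Dual vectors. The vectors $\lambda^\star\in\mathbb{R}^m$ and $\nu^\star\in\mathbb{R}^q$ are the Lagrange multipliers, common to all players, of the shared inequality and equality constraints in the joint KKT conditions of the game: $Fx^\star+f+A^\top\lambda^\star+E^\top\nu^\star=0$,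 $Ex^\star=e$, $Ax^\star\le b$, $\lambda^\star\ge 0$, $(\lambda^\star)^\top(Ax^\star-b)=0$. When $q=0$ there is no $\nu$ and the terms involving $E$, $M$, $e$ are absent, so that $P=G=F^{-1}$. *)

theory Defs
  imports
    "HOL-Analysis.Derivative"
    "Jordan_Normal_Form.Gauss_Jordan_Elimination"
    "Jordan_Normal_Form.DL_Rank"
begin

text \<open>Vectors and matrices are those of Jordan-Normal-Form, with explicit carriers, because the
  numbers \<open>m\<close> and \<open>q\<close> of shared constraints may be zero. Players are numbered
  \<open>0, \<dots>, N - 1\<close>; player \<open>i\<close> has \<open>nd i\<close> decision variables, and \<open>x\<close> is the concatenation of the
  players' decisions in order.\<close>

no_notation inner (infix "\<bullet>" 70)

subsection \<open>The game\<close>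

definition game_dim :: "nat \<Rightarrow> (nat \<Rightarrow> nat) \<Rightarrow> nat" where
  "game_dim N nd = (\<Sum>i<N. nd i)"

text \<open>The player whose block contains the (global) coordinate \<open>r\<close>.\<close>

definition owner :: "(nat \<Rightarrow> nat) \<Rightarrow> nat \<Rightarrow> nat" where
  "owner nd r = (LEAST i. r < (\<Sum>j\<le>i. nd j))"

definition cost :: "real mat \<Rightarrow> real vec \<Rightarrow> real vec \<Rightarrow> real" where
  "cost Q c x = 1 / 2 * (x \<bullet> (Q *\<^sub>v x)) + c \<bullet> x"

text \<open>Coordinate \<open>r\<close> of the stacked gradients is the partial derivative, along coordinate \<open>r\<close>, of
  the cost of the player who owns that coordinate.\<close>

definition pseudogradient ::
  "nat \<Rightarrow> (nat \<Rightarrow> nat) \<Rightarrow> (nat \<Rightarrow> real mat) \<Rightarrow> (nat \<Rightarrow> real vec) \<Rightarrow> real vec \<Rightarrow> real vec" where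
  "pseudogradient N nd Q c x = vec (game_dim N nd) (\<lambda>r.
     deriv (\<lambda>t. cost (Q (owner nd r)) (c (owner nd r)) (x + t \<cdot>\<^sub>v unit_vec (game_dim N nd) r)) 0)"

definition pseudogradient_mat :: "nat \<Rightarrow> (nat \<Rightarrow> nat) \<Rightarrow> (nat \<Rightarrow> real mat) \<Rightarrow> real mat" where
  "pseudogradient_mat N nd Q =
     mat (game_dim N nd) (game_dim N nd) (\<lambda>(r, s). Q (owner nd r) $$ (r, s))"

definition pseudogradient_vec :: "nat \<Rightarrow> (nat \<Rightarrow> nat) \<Rightarrow> (nat \<Rightarrow> real vec) \<Rightarrow> real vec" where
  "pseudogradient_vec N nd c = vec (game_dim N nd) (\<lambda>r. c (owner nd r) $ r)"

text \<open>The order on vectors is the componentwise one.\<close>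

definition shared_set :: "real mat \<Rightarrow> real vec \<Rightarrow> real mat \<Rightarrow> real vec \<Rightarrow> real vec set" where
  "shared_set A b E e = {x \<in> carrier_vec (dim_col A). A *\<^sub>v x \<le> b \<and> E *\<^sub>v x = e}"

definition is_vGNE :: "(real vec \<Rightarrow> real vec) \<Rightarrow> real vec set \<Rightarrow> real vec \<Rightarrow> bool" where
  "is_vGNE \<phi> X x \<longleftrightarrow> x \<in> X \<and> (\<forall>y\<in>X. 0 \<le> \<phi> x \<bullet> (y - x))"

definition joint_KKT :: "(real vec \<Rightarrow> real vec) \<Rightarrow> real mat \<Rightarrow> real vec \<Rightarrow> real mat \<Rightarrow> real vec \<Rightarrow>
    real vec \<Rightarrow> real vec \<Rightarrow> real vec \<Rightarrow> bool" where
  "joint_KKT \<phi> A b E e x l nu \<longleftrightarrow>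
     x \<in> carrier_vec (dim_col A) \<and> l \<in> carrier_vec (dim_row A) \<and> nu \<in> carrier_vec (dim_row E) \<and>
     \<phi> x + A\<^sup>T *\<^sub>v l + E\<^sup>T *\<^sub>v nu = 0\<^sub>v (dim_col A) \<and>
     E *\<^sub>v x = e \<and> A *\<^sub>v x \<le> b \<and> 0\<^sub>v (dim_row A) \<le> l \<and> l \<bullet> (A *\<^sub>v x - b) = 0"

subsection \<open>Matrices and convexity\<close>

text \<open>Meaningful for invertible matrices only. The empty matrix is its own inverse.\<close>

definition mat_inv :: "real mat \<Rightarrow> real mat" where
  "mat_inv A = the (mat_inverse A)"

definition psd :: "nat \<Rightarrow> real mat \<Rightarrow> bool" where
  "psd n A \<longleftrightarrow> A \<in> carrier_mat n n \<and> A\<^sup>T = A \<and> (\<forall>x\<in>carrier_vec n. 0 \<le> x \<bullet> (A *\<^sub>v x))"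

text \<open>The vectors do not form a \<open>real_vector\<close> type, so convexity is spelled out on the carrier.\<close>

definition convex_vecs :: "real vec set \<Rightarrow> bool" where
  "convex_vecs S \<longleftrightarrow> (\<forall>u\<in>S. \<forall>v\<in>S. \<forall>t\<in>{0..1}. (1 - t) \<cdot>\<^sub>v u + t \<cdot>\<^sub>v v \<in> S)"

definition convex_on_vecs :: "real vec set \<Rightarrow> (real vec \<Rightarrow> real) \<Rightarrow> bool" where
  "convex_on_vecs S g \<longleftrightarrow> convex_vecs S \<and>
     (\<forall>u\<in>S. \<forall>v\<in>S. \<forall>t\<in>{0..1}. g ((1 - t) \<cdot>\<^sub>v u + t \<cdot>\<^sub>v v) \<le> (1 - t) * g u + t * g v)"

subsection \<open>The quadratic program\<close>

definition qp_objective :: "real mat \<Rightarrow> real vec \<Rightarrow> real vec \<Rightarrow> real" where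
  "qp_objective Hs q0 l = l \<bullet> (Hs *\<^sub>v l) + q0 \<bullet> l"

definition qp_feasible :: "nat \<Rightarrow> real mat \<Rightarrow> real vec \<Rightarrow> real vec set" where
  "qp_feasible m H q0 = {l \<in> carrier_vec m. 0\<^sub>v m \<le> H *\<^sub>v l + q0 \<and> 0\<^sub>v m \<le> l}"

definition qp_optimal :: "nat \<Rightarrow> real mat \<Rightarrow> real mat \<Rightarrow> real vec \<Rightarrow> real vec \<Rightarrow> bool" where
  "qp_optimal m Hs H q0 l \<longleftrightarrow> is_arg_min (qp_objective Hs q0) (\<lambda>l. l \<in> qp_feasible m H q0) l"

subsection \<open>Consistency of the definitions\<close>

lemma mat_inv:
  assumes "A \<in> carrier_mat n n" "invertible_mat A"
  shows "mat_inv A \<in> carrier_mat n n" "A * mat_inv A = 1\<^sub>m n" "mat_inv A * A = 1\<^sub>m n"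
proof -
  obtain B where B: "A * B = 1\<^sub>m n" "B * A = 1\<^sub>m (dim_row B)"
    using assms unfolding invertible_mat_def inverts_mat_def by auto
  have "B \<in> carrier_mat n n"
    using assms(1) arg_cong[OF B(1), of dim_col] arg_cong[OF B(2), of dim_col] by auto
  with B assms(1) have "A \<in> Units (ring_mat TYPE(real) n ())"
    unfolding Units_def by (auto simp: ring_mat_def)
  then obtain C where C: "mat_inverse A = Some C"
    using mat_inverse(1)[OF assms(1), where b = "()"] by (cases "mat_inverse A") auto
  show "mat_inv A \<in> carrier_mat n n" "A * mat_inv A = 1\<^sub>m n" "mat_inv A * A = 1\<^sub>m n"
    using mat_inverse(2)[OF assms(1) C] C by (auto simp: mat_inv_def)
qed

lemma owner_block:
  assumes "i < N" "k < nd i"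
  shows "owner nd ((\<Sum>j<i. nd j) + k) = i"
  unfolding owner_def
proof (rule Least_equality)
  show "(\<Sum>j<i. nd j) + k < (\<Sum>j\<le>i. nd j)"
    using assms by (simp flip: lessThan_Suc_atMost)
next
  fix i' assume *: "(\<Sum>j<i. nd j) + k < (\<Sum>j\<le>i'. nd j)"
  show "i \<le> i'"
  proof (rule ccontr)
    assume "\<not> i \<le> i'"
    then have "(\<Sum>j\<le>i'. nd j) \<le> (\<Sum>j<i. nd j)" by (intro sum_mono2) auto
    with * show False by simp
  qed
qed

lemma owner_less:
  assumes "r < game_dim N nd"
  shows "owner nd r < N"
proof -
  obtain K where N: "N = Suc K" using assms by (cases N) (auto simp: game_dim_def)
  have "r < (\<Sum>j\<le>K. nd j)" using assms by (simp add: game_dim_def N flip: lessThan_Suc_atMost)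
  then have "owner nd r \<le> K" unfolding owner_def by (rule Least_le)
  then show ?thesis using N by simp
qed

lemma cost_partial_derivative:
  assumes Q: "Q \<in> carrier_mat n n" "Q\<^sup>T = Q" and c: "c \<in> carrier_vec n"
    and x: "x \<in> carrier_vec n" and r: "r < n"
  shows "((\<lambda>t. cost Q c (x + t \<cdot>\<^sub>v unit_vec n r)) has_real_derivative (Q *\<^sub>v x) $ r + c $ r) (at 0)"
proof -
  let ?u = "unit_vec n r :: real vec"
  have u: "?u \<in> carrier_vec n" by simp
  have xQu: "x \<bullet> (Q *\<^sub>v ?u) = ?u \<bullet> (Q *\<^sub>v x)"
  proof -
    have "x \<bullet> (Q *\<^sub>v ?u) = (Q\<^sup>T *\<^sub>v x) \<bullet> ?u"
      using transpose_vec_mult_scalar[OF Q(1) u x] by simp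
    then show ?thesis
      using Q u x by (simp add: comm_scalar_prod[of "Q *\<^sub>v x" n ?u])
  qed
  have uQx: "?u \<bullet> (Q *\<^sub>v x) = (Q *\<^sub>v x) $ r"
    using Q x r by (simp add: scalar_prod_left_unit)
  have cu: "c \<bullet> ?u = c $ r" using c r by (simp add: scalar_prod_right_unit)
  have "cost Q c (x + t \<cdot>\<^sub>v ?u) = cost Q c x + t * ((Q *\<^sub>v x) $ r + c $ r)
      + t ^ 2 * (1 / 2 * (?u \<bullet> (Q *\<^sub>v ?u)))" for t
  proof -
    have tu: "t \<cdot>\<^sub>v ?u \<in> carrier_vec n" by simp
    have Qx: "Q *\<^sub>v x \<in> carrier_vec n" and Qu: "Q *\<^sub>v ?u \<in> carrier_vec n" using Q x by auto
    then have tQu: "t \<cdot>\<^sub>v (Q *\<^sub>v ?u) \<in> carrier_vec n" by simp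
    have "Q *\<^sub>v (x + t \<cdot>\<^sub>v ?u) = Q *\<^sub>v x + t \<cdot>\<^sub>v (Q *\<^sub>v ?u)"
      using mult_add_distrib_mat_vec[OF Q(1) x tu] mult_mat_vec[OF Q(1) u] by simp
    then have "(x + t \<cdot>\<^sub>v ?u) \<bullet> (Q *\<^sub>v (x + t \<cdot>\<^sub>v ?u)) =
        x \<bullet> (Q *\<^sub>v x) + t * (x \<bullet> (Q *\<^sub>v ?u)) + (t * (?u \<bullet> (Q *\<^sub>v x)) + t * (t * (?u \<bullet> (Q *\<^sub>v ?u))))"
      using x u tu Qx Qu tQu
        add_scalar_prod_distrib[OF x tu, of "Q *\<^sub>v x + t \<cdot>\<^sub>v (Q *\<^sub>v ?u)"]
        scalar_prod_add_distrib[OF x Qx tQu] scalar_prod_add_distrib[OF tu Qx tQu]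
        smult_scalar_prod_distrib[OF u Qx] smult_scalar_prod_distrib[OF u tQu]
        scalar_prod_smult_distrib[OF u Qu]
      by (simp del: scalar_prod_left_unit scalar_prod_right_unit)
    moreover have "c \<bullet> (x + t \<cdot>\<^sub>v ?u) = c \<bullet> x + t * (c \<bullet> ?u)"
      using scalar_prod_add_distrib[OF c x tu] c u
      by (simp del: scalar_prod_left_unit scalar_prod_right_unit)
    ultimately show ?thesis
      unfolding cost_def xQu uQx cu by (simp add: algebra_simps power2_eq_square)
  qed
  then show ?thesis by (auto intro!: derivative_eq_intros)
qed

lemma pseudogradient_affine:
  assumes "\<And>i. i < N \<Longrightarrow> Q i \<in> carrier_mat (game_dim N nd) (game_dim N nd)"
    and "\<And>i. i < N \<Longrightarrow> (Q i)\<^sup>T = Q i"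
    and "\<And>i. i < N \<Longrightarrow> c i \<in> carrier_vec (game_dim N nd)"
    and "x \<in> carrier_vec (game_dim N nd)"
  shows "pseudogradient N nd Q c x =
    pseudogradient_mat N nd Q *\<^sub>v x + pseudogradient_vec N nd c"
proof (rule eq_vecI)
  fix r assume "r < dim_vec (pseudogradient_mat N nd Q *\<^sub>v x + pseudogradient_vec N nd c)"
  then have r: "r < game_dim N nd" by (simp add: pseudogradient_vec_def)
  define i where "i = owner nd r"
  have i: "i < N" using owner_less[OF r] by (simp add: i_def)
  have "row (pseudogradient_mat N nd Q) r = row (Q i) r"
    using assms(1)[OF i] r by (auto simp: pseudogradient_mat_def i_def)
  moreover have "pseudogradient N nd Q c x $ r = (Q i *\<^sub>v x) $ r + c i $ r"
    using DERIV_imp_deriv[OF cost_partial_derivative[OF assms(1)[OF i] assms(2)[OF i] assms(3)[OF i] assms(4) r]] r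
    by (simp add: pseudogradient_def i_def)
  ultimately show "pseudogradient N nd Q c x $ r =
      (pseudogradient_mat N nd Q *\<^sub>v x + pseudogradient_vec N nd c) $ r"
    using r assms(1)[OF i] by (simp add: pseudogradient_vec_def pseudogradient_mat_def i_def)
qed (simp add: pseudogradient_def pseudogradient_vec_def)

text \<open>Without equality constraints the correction term of \<open>P\<close> vanishes.\<close>

lemma no_equality_constraints:
  assumes "G \<in> carrier_mat n n" "E \<in> carrier_mat 0 n"
  shows "G - G * E\<^sup>T * mat_inv M * E * G = G"
proof -
  have "G * E\<^sup>T * mat_inv M * E = 0\<^sub>m n n"
    using assms by (intro eq_matI) (auto simp: scalar_prod_def)
  then show ?thesis using assms by (intro eq_matI) auto
qed

end

theory Submission
  imports Defs
begin

text \<open>Farkas' lemma, proved by induction on the number of constraints, supplies multipliers for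
  every variational inequality over a polyhedron; hence the v-GNEs are the primal parts of the
  joint KKT points. Since \<open>F\<close> and \<open>M\<close> are invertible, stationarity together with \<open>E x = e\<close> determines
  \<open>x\<close> and \<open>\<nu>\<close> from \<open>\<lambda>\<close>, and \<open>b - A x = H \<lambda> + q\<^sub>0\<close>; what remains of the KKT system is the linear
  complementarity problem \<open>\<lambda> \<ge> 0\<close>, \<open>H \<lambda> + q\<^sub>0 \<ge> 0\<close>, \<open>\<lambda> \<bullet> (H \<lambda> + q\<^sub>0) = 0\<close>. The matrix \<open>P\<close>, hence \<open>H\<close>,
  inherits a nonnegative quadratic form from \<open>F\<close>. The objective of the quadratic program is
  \<open>\<lambda> \<bullet> (H \<lambda> + q\<^sub>0)\<close>, which is nonnegative on the feasible set; monotonicity of \<open>H\<close> forces it to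
  vanish at every minimizer.\<close>

unbundle no vec_syntax

section \<open>Farkas' lemma and multipliers\<close>

text \<open>\<open>K\<close> marks the constraints that hold with equality, whose multipliers carry
  no sign. If the remaining constraints already force \<open>g \<bullet> d \<le> 0\<close>,
  constraint \<open>k\<close> gets multiplier 0. Otherwise a direction \<open>z\<close> witnesses
  the failure, and projecting along \<open>z\<close> onto the kernel of \<open>a k\<close> leaves
  one constraint fewer. Expressing \<open>g\<close> through its pairings with all \<open>d\<close>
  avoids sums of vectors.\<close>

lemma farkas:
  fixes a :: "'i \<Rightarrow> 'a :: linordered_field vec"
  assumes "finite I" "\<And>i. i \<in> I \<Longrightarrow> a i \<in> carrier_vec n" "g \<in> carrier_vec n"
    and "\<And>d. d \<in> carrier_vec n \<Longrightarrow> (\<And>i. i \<in> I \<Longrightarrow> a i \<bullet> d \<le> 0) \<Longrightarrow>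
      (\<And>i. i \<in> I \<Longrightarrow> i \<in> K \<Longrightarrow> a i \<bullet> d = 0) \<Longrightarrow> g \<bullet> d \<le> 0"
  shows "\<exists>l. (\<forall>i\<in>I - K. 0 \<le> l i) \<and> (\<forall>d\<in>carrier_vec n. g \<bullet> d = (\<Sum>i\<in>I. l i * (a i \<bullet> d)))"
  using assms
proof (induction I arbitrary: a g rule: finite_induct)
  case empty
  have "g \<bullet> d = 0" if d: "d \<in> carrier_vec n" for d
  proof -
    have "g \<bullet> d \<le> 0" "g \<bullet> (- d) \<le> 0" using d by (auto intro!: empty.prems(3))
    then show ?thesis using d empty.prems(2) by simp
  qed
  then show ?case by simp
next
  case (insert k I)
  have ak: "a k \<in> carrier_vec n" and aI: "\<And>i. i \<in> I \<Longrightarrow> a i \<in> carrier_vec n"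
    using insert.prems(1) by auto
  note g = insert.prems(2)
  show ?case
  proof (cases "\<forall>d\<in>carrier_vec n. (\<forall>i\<in>I. a i \<bullet> d \<le> 0 \<and> (i \<in> K \<longrightarrow> a i \<bullet> d = 0)) \<longrightarrow> g \<bullet> d \<le> 0")
    case True
    then have "\<exists>l. (\<forall>i\<in>I - K. 0 \<le> l i) \<and> (\<forall>d\<in>carrier_vec n. g \<bullet> d = (\<Sum>i\<in>I. l i * (a i \<bullet> d)))"
      by (intro insert.IH aI g) auto
    then obtain l where l: "\<forall>i\<in>I - K. 0 \<le> l i" "\<forall>d\<in>carrier_vec n. g \<bullet> d = (\<Sum>i\<in>I. l i * (a i \<bullet> d))"
      by blast
    have "(\<Sum>i\<in>I. (l(k := 0)) i * (a i \<bullet> d)) = (\<Sum>i\<in>I. l i * (a i \<bullet> d))" for d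
      using insert.hyps(2) by (intro sum.cong) auto
    then show ?thesis
      using l insert.hyps by (intro exI[of _ "l(k := 0)"]) auto
  next
    case False
    then obtain z where z: "z \<in> carrier_vec n" "\<forall>i\<in>I. a i \<bullet> z \<le> 0 \<and> (i \<in> K \<longrightarrow> a i \<bullet> z = 0)"
      "g \<bullet> z > 0" by auto
    define s where "s = a k \<bullet> z"
    \<comment> \<open>\<open>z\<close> meets every constraint in \<open>I\<close> although
      \<open>g \<bullet> z > 0\<close>, so it must violate constraint \<open>k\<close>.\<close>
    have s: "s \<noteq> 0" "k \<notin> K \<Longrightarrow> 0 < s"
      using insert.prems(3)[OF z(1)] z(2,3) unfolding s_def by force+
    text \<open>Subtracting a multiple of \<open>a k\<close> is composing with the projection along \<open>z\<close> onto the
      kernel of \<open>a k\<close>.\<close>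
    define p where "p v = v - (v \<bullet> z / s) \<cdot>\<^sub>v a k" for v
    have p: "p v \<in> carrier_vec n" "p v \<bullet> d = v \<bullet> d - v \<bullet> z / s * (a k \<bullet> d)"
      "p v \<bullet> d = v \<bullet> (d - (a k \<bullet> d / s) \<cdot>\<^sub>v z)"
      if "v \<in> carrier_vec n" "d \<in> carrier_vec n" for v d
      using that ak z(1) unfolding p_def
      by (simp_all add: minus_scalar_prod_distrib[where n = n] scalar_prod_minus_distrib[where n = n])
    have "\<exists>l. (\<forall>i\<in>I - K. 0 \<le> l i) \<and> (\<forall>d\<in>carrier_vec n. p g \<bullet> d = (\<Sum>i\<in>I. l i * (p (a i) \<bullet> d)))"
    proof (rule insert.IH)
      fix d assume d: "d \<in> carrier_vec n" "\<And>i. i \<in> I \<Longrightarrow> p (a i) \<bullet> d \<le> 0"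
        "\<And>i. i \<in> I \<Longrightarrow> i \<in> K \<Longrightarrow> p (a i) \<bullet> d = 0"
      define d' where "d' = d - (a k \<bullet> d / s) \<cdot>\<^sub>v z"
      have d': "d' \<in> carrier_vec n" using d(1) z(1) by (simp add: d'_def)
      have "a k \<bullet> d' = 0"
        using ak d(1) z(1) s(1) unfolding d'_def
        by (simp add: scalar_prod_minus_distrib[where n = n] s_def[symmetric])
      moreover have "a i \<bullet> d' = p (a i) \<bullet> d" if "i \<in> I" for i
        using p(3)[OF aI[OF that] d(1)] by (simp add: d'_def)
      ultimately have "g \<bullet> d' \<le> 0"
        using d by (intro insert.prems(3) d') auto
      then show "p g \<bullet> d \<le> 0" using p(3)[OF g d(1)] by (simp add: d'_def)
    qed (use p(1)[OF _ z(1)] aI g in auto)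
    then obtain l where l: "\<forall>i\<in>I - K. 0 \<le> l i"
      "\<forall>d\<in>carrier_vec n. p g \<bullet> d = (\<Sum>i\<in>I. l i * (p (a i) \<bullet> d))" by blast
    \<comment> \<open>The wanted identity, evaluated at \<open>z\<close>, forces this coefficient,
      since \<open>a k \<bullet> z = s\<close>. If \<open>k\<close> is an inequality, then
      \<open>s > 0\<close>, \<open>g \<bullet> z > 0\<close> and the sum is at most 0, which makes
      it nonnegative.\<close>
    define c where "c = (g \<bullet> z - (\<Sum>i\<in>I. l i * (a i \<bullet> z))) / s"
    have "(\<Sum>i\<in>I. l i * (a i \<bullet> z)) \<le> 0"
      using z(2) l(1) by (intro sum_nonpos) (metis DiffI mult_nonneg_nonpos mult_zero_right order_refl)
    then have c: "0 \<le> c" if "k \<notin> K" using s(2)[OF that] z(3) unfolding c_def by auto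
    have eq: "g \<bullet> d = c * (a k \<bullet> d) + (\<Sum>i\<in>I. l i * (a i \<bullet> d))" if d: "d \<in> carrier_vec n" for d
    proof -
      \<comment> \<open>This is the identity for the projected vectors with \<open>p\<close>
        unfolded; the terms in \<open>a k \<bullet> d\<close> then collect to the coefficient
        \<open>c\<close>.\<close>
      have "g \<bullet> d - g \<bullet> z / s * (a k \<bullet> d) =
          (\<Sum>i\<in>I. l i * (a i \<bullet> d) - l i * (a i \<bullet> z) * (a k \<bullet> d / s))"
        using bspec[OF l(2) d] p(2)[OF g d] by (auto simp: p(2)[OF aI d] algebra_simps intro!: sum.cong)
      also have "\<dots> = (\<Sum>i\<in>I. l i * (a i \<bullet> d)) - (\<Sum>i\<in>I. l i * (a i \<bullet> z)) * (a k \<bullet> d / s)"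
        by (simp only: sum_subtractf sum_distrib_right)
      finally show ?thesis using s(1) by (simp add: c_def field_simps)
    qed
    have "(\<Sum>i\<in>I. (l(k := c)) i * (a i \<bullet> d)) = (\<Sum>i\<in>I. l i * (a i \<bullet> d))" for d
      using insert.hyps(2) by (intro sum.cong) auto
    then show ?thesis
      using l(1) c eq insert.hyps by (intro exI[of _ "l(k := c)"]) auto
  qed
qed

text \<open>A direction satisfying the linearized constraints active at \<open>x\<close> stays
  feasible for a short step, so the variational inequality makes \<open>- g\<close> nonpositive on
  the cone of such directions and \<open>farkas\<close> applies to it. Inactive constraints get
  multiplier 0, which is complementary slackness.\<close>

lemma lagrange_multipliers:
  fixes a :: "'i \<Rightarrow> 'a :: linordered_field vec"
  assumes I: "finite I" and a: "\<And>i. i \<in> I \<Longrightarrow> a i \<in> carrier_vec n"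
    and g: "g \<in> carrier_vec n" and x: "x \<in> carrier_vec n"
    and le: "\<And>i. i \<in> I \<Longrightarrow> a i \<bullet> x \<le> \<beta> i"
    and eq: "\<And>i. i \<in> I \<Longrightarrow> i \<in> K \<Longrightarrow> a i \<bullet> x = \<beta> i"
    and vi: "\<And>y. y \<in> carrier_vec n \<Longrightarrow> (\<And>i. i \<in> I \<Longrightarrow> a i \<bullet> y \<le> \<beta> i) \<Longrightarrow>
      (\<And>i. i \<in> I \<Longrightarrow> i \<in> K \<Longrightarrow> a i \<bullet> y = \<beta> i) \<Longrightarrow> 0 \<le> g \<bullet> (y - x)"
  obtains l where "\<And>i. i \<in> I - K \<Longrightarrow> 0 \<le> l i"
    "\<And>i. i \<in> I \<Longrightarrow> l i * (a i \<bullet> x - \<beta> i) = 0"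
    "\<And>d. d \<in> carrier_vec n \<Longrightarrow> g \<bullet> d + (\<Sum>i\<in>I. l i * (a i \<bullet> d)) = 0"
proof -
  define J where "J = {i \<in> I. a i \<bullet> x = \<beta> i}"
  have J: "finite J" "J \<subseteq> I" using I by (auto simp: J_def)
  have "\<exists>l. (\<forall>i\<in>J - K. 0 \<le> l i) \<and> (\<forall>d\<in>carrier_vec n. (- g) \<bullet> d = (\<Sum>i\<in>J. l i * (a i \<bullet> d)))"
  proof (rule farkas)
    fix d assume d: "d \<in> carrier_vec n" "\<And>i. i \<in> J \<Longrightarrow> a i \<bullet> d \<le> 0"
      "\<And>i. i \<in> J \<Longrightarrow> i \<in> K \<Longrightarrow> a i \<bullet> d = 0"
    \<comment> \<open>Ratio test: \<open>t\<close> is a step short enough to preserve every inactive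
      constraint. The element 1 covers the case of no inactive constraint, and \<open>1 +\<close>
      keeps the denominators positive.\<close>
    define S where "S = insert 1 ((\<lambda>i. (\<beta> i - a i \<bullet> x) / (1 + \<bar>a i \<bullet> d\<bar>)) ` (I - J))"
    define t where "t = Min S"
    have S: "finite S" "S \<noteq> {}" using I by (auto simp: S_def)
    have pos: "0 < \<beta> i - a i \<bullet> x" if "i \<in> I - J" for i
      using that le[of i] by (auto simp: J_def)
    have t: "0 < t" using S pos by (auto simp: t_def S_def intro!: divide_pos_pos)
    have step: "a i \<bullet> (x + t \<cdot>\<^sub>v d) = a i \<bullet> x + t * (a i \<bullet> d)" if "i \<in> I" for i
      using a[OF that] x d(1) by (simp add: scalar_prod_add_distrib[where n = n])
    have "0 \<le> g \<bullet> ((x + t \<cdot>\<^sub>v d) - x)"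
    proof (rule vi)
      fix i assume i: "i \<in> I"
      show "a i \<bullet> (x + t \<cdot>\<^sub>v d) \<le> \<beta> i"
      proof (cases "i \<in> J")
        case True
        then show ?thesis using d(2)[OF True] t step[OF i] by (simp add: J_def mult_le_0_iff)
      next
        case False
        then have "t \<le> (\<beta> i - a i \<bullet> x) / (1 + \<bar>a i \<bullet> d\<bar>)"
          using S i by (auto simp: t_def S_def)
        then have "t * (1 + \<bar>a i \<bullet> d\<bar>) \<le> \<beta> i - a i \<bullet> x"
          by (subst (asm) pos_le_divide_eq) auto
        moreover have "t * (a i \<bullet> d) \<le> t * (1 + \<bar>a i \<bullet> d\<bar>)"
          using t by (intro mult_left_mono) auto
        ultimately show ?thesis using step[OF i] by simp
      qed
    next
      fix i assume "i \<in> I" "i \<in> K"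
      then show "a i \<bullet> (x + t \<cdot>\<^sub>v d) = \<beta> i"
        using step eq[of i] d(3)[of i] by (auto simp: J_def)
    qed (use x d(1) in auto)
    moreover have "(x + t \<cdot>\<^sub>v d) - x = t \<cdot>\<^sub>v d" using x d(1) by (intro eq_vecI) auto
    ultimately show "(- g) \<bullet> d \<le> 0" using g d(1) t by (simp add: zero_le_mult_iff)
  qed (use J a g in auto)
  then obtain l where l: "\<forall>i\<in>J - K. 0 \<le> l i"
    "\<forall>d\<in>carrier_vec n. (- g) \<bullet> d = (\<Sum>i\<in>J. l i * (a i \<bullet> d))" by blast
  \<comment> \<open>Extension by 0 to the inactive constraints.\<close>
  define l' where "l' i = (if i \<in> J then l i else 0)" for i
  have "(\<Sum>i\<in>I. l' i * (a i \<bullet> d)) = (\<Sum>i\<in>J. l i * (a i \<bullet> d))" for d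
    unfolding l'_def using I J(2) by (intro sum.mono_neutral_cong_right) auto
  moreover have "- (g \<bullet> d) = (\<Sum>i\<in>J. l i * (a i \<bullet> d))" if "d \<in> carrier_vec n" for d
    using bspec[OF l(2) that] g that by simp
  ultimately have "g \<bullet> d + (\<Sum>i\<in>I. l' i * (a i \<bullet> d)) = 0" if "d \<in> carrier_vec n" for d
    using that by (metis add.right_inverse)
  moreover have "0 \<le> l' i" if "i \<in> I - K" for i using that l(1) by (auto simp: l'_def)
  moreover have "l' i * (a i \<bullet> x - \<beta> i) = 0" for i by (auto simp: l'_def J_def)
  ultimately show ?thesis by (rule that[rotated 2])
qed

section \<open>Quadratic programs\<close>

text \<open>The exact second-order expansion along a line, used both for convexity and for
  first-order optimality. Both cross terms appear because \<open>H\<close> may be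
  asymmetric.\<close>

lemma qp_objective_line:
  assumes H: "H \<in> carrier_mat m m" and q: "q \<in> carrier_vec m"
    and u: "u \<in> carrier_vec m" and d: "d \<in> carrier_vec m"
  shows "qp_objective H q (u + t \<cdot>\<^sub>v d) =
    qp_objective H q u + t * (u \<bullet> (H *\<^sub>v d) + d \<bullet> (H *\<^sub>v u) + q \<bullet> d) + t\<^sup>2 * (d \<bullet> (H *\<^sub>v d))"
proof -
  have "H *\<^sub>v (u + t \<cdot>\<^sub>v d) = H *\<^sub>v u + t \<cdot>\<^sub>v (H *\<^sub>v d)"
    using mult_add_distrib_mat_vec[OF H u, of "t \<cdot>\<^sub>v d"] mult_mat_vec[OF H d] d by simp
  moreover have "H *\<^sub>v u \<in> carrier_vec m" "H *\<^sub>v d \<in> carrier_vec m" using H u d by auto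
  ultimately show ?thesis
    unfolding qp_objective_def using q u d
    by (simp add: scalar_prod_add_distrib[where n = m] add_scalar_prod_distrib[where n = m]
        algebra_simps power2_eq_square)
qed

text \<open>With \<open>d = v - u\<close>, the gap in the convexity inequality is exactly
  \<open>t * (1 - t) * (d \<bullet> (H *\<^sub>v d))\<close>.\<close>

lemma convex_on_qp_objective:
  assumes "psd m H" and q: "q \<in> carrier_vec m"
  shows "convex_on_vecs (carrier_vec m) (qp_objective H q)"
proof -
  have H: "H \<in> carrier_mat m m" and nn: "\<And>x. x \<in> carrier_vec m \<Longrightarrow> 0 \<le> x \<bullet> (H *\<^sub>v x)"
    using assms(1) by (auto simp: psd_def)
  have "qp_objective H q ((1 - t) \<cdot>\<^sub>v u + t \<cdot>\<^sub>v v) \<le> (1 - t) * qp_objective H q u + t * qp_objective H q v"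
    if u: "u \<in> carrier_vec m" and v: "v \<in> carrier_vec m" and t: "0 \<le> t" "t \<le> 1" for u v t
  proof -
    define d where "d = v - u"
    have d: "d \<in> carrier_vec m" using u v by (simp add: d_def)
    have 1: "(1 - t) \<cdot>\<^sub>v u + t \<cdot>\<^sub>v v = u + t \<cdot>\<^sub>v d" and 2: "v = u + d"
      using u v unfolding d_def by (auto intro!: eq_vecI simp: algebra_simps)
    have "qp_objective H q v =
        qp_objective H q u + (u \<bullet> (H *\<^sub>v d) + d \<bullet> (H *\<^sub>v u) + q \<bullet> d) + d \<bullet> (H *\<^sub>v d)"
      using qp_objective_line[OF H q u d, of 1] by (simp add: 2)
    moreover have "0 \<le> t * (1 - t) * (d \<bullet> (H *\<^sub>v d))" using t nn[OF d] by simp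
    ultimately show ?thesis
      unfolding 1 qp_objective_line[OF H q u d] by (simp add: algebra_simps power2_eq_square)
  qed
  then show ?thesis by (auto simp: convex_on_vecs_def convex_vecs_def)
qed

lemma convex_qp_feasible:
  assumes H: "H \<in> carrier_mat m m" and q: "q \<in> carrier_vec m"
  shows "convex_vecs (qp_feasible m H q)"
  unfolding convex_vecs_def
proof (intro ballI)
  fix u v and t :: real
  assume u: "u \<in> qp_feasible m H q" and v: "v \<in> qp_feasible m H q" and t: "t \<in> {0..1}"
  have uv: "u \<in> carrier_vec m" "v \<in> carrier_vec m" using u v by (auto simp: qp_feasible_def)
  have "H *\<^sub>v ((1 - t) \<cdot>\<^sub>v u + t \<cdot>\<^sub>v v) = (1 - t) \<cdot>\<^sub>v (H *\<^sub>v u) + t \<cdot>\<^sub>v (H *\<^sub>v v)"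
    using uv H by (simp add: mult_add_distrib_mat_vec[where nr = m and nc = m] mult_mat_vec[where nr = m and nc = m])
  then have "H *\<^sub>v ((1 - t) \<cdot>\<^sub>v u + t \<cdot>\<^sub>v v) + q = (1 - t) \<cdot>\<^sub>v (H *\<^sub>v u + q) + t \<cdot>\<^sub>v (H *\<^sub>v v + q)"
    using uv H q by (intro eq_vecI) (auto simp: algebra_simps simp del: index_mult_mat_vec)
  moreover have "0\<^sub>v m \<le> (1 - t) \<cdot>\<^sub>v x + t \<cdot>\<^sub>v y"
    if "x \<in> carrier_vec m" "y \<in> carrier_vec m" "0\<^sub>v m \<le> x" "0\<^sub>v m \<le> y" for x y
    using that t by (simp add: less_eq_vec_def)
  ultimately show "(1 - t) \<cdot>\<^sub>v u + t \<cdot>\<^sub>v v \<in> qp_feasible m H q"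
    using u v uv H q by (simp add: qp_feasible_def)
qed

section \<open>Minimizers of the quadratic program and linear complementarity\<close>

lemma scalar_prod_nonneg_vec:
  fixes u v :: "'a :: linordered_semidom vec"
  assumes "u \<in> carrier_vec m" "v \<in> carrier_vec m" "0\<^sub>v m \<le> u" "0\<^sub>v m \<le> v"
  shows "0 \<le> u \<bullet> v"
  using assms by (auto simp: scalar_prod_def less_eq_vec_def intro!: sum_nonneg)

text \<open>The linear complementarity problem: its inequalities are those of the quadratic program,
  so only complementarity is added to feasibility.\<close>

definition lcp_solution :: "nat \<Rightarrow> real mat \<Rightarrow> real vec \<Rightarrow> real vec \<Rightarrow> bool" where
  "lcp_solution m H q l \<longleftrightarrow> l \<in> qp_feasible m H q \<and> l \<bullet> (H *\<^sub>v l + q) = 0"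

text \<open>With \<open>u = v\<close> the symmetric part has the same quadratic form as
  \<open>H\<close>; the bilinear version also covers the cross terms of the expansion along a
  line.\<close>

lemma symmetric_part_quadratic_form:
  fixes H :: "real mat"
  assumes H: "H \<in> carrier_mat m m" and u: "u \<in> carrier_vec m" and v: "v \<in> carrier_vec m"
  shows "u \<bullet> ((1 / 2 \<cdot>\<^sub>m (H + H\<^sup>T)) *\<^sub>v v) = (u \<bullet> (H *\<^sub>v v) + v \<bullet> (H *\<^sub>v u)) / 2"
proof -
  have "(1 / 2 \<cdot>\<^sub>m (H + H\<^sup>T)) *\<^sub>v v = (1 / 2) \<cdot>\<^sub>v (H *\<^sub>v v + H\<^sup>T *\<^sub>v v)"
    using H v by (intro eq_vecI) (auto simp: add_scalar_prod_distrib[where n = m])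
  moreover have "u \<bullet> (H\<^sup>T *\<^sub>v v) = v \<bullet> (H *\<^sub>v u)"
    using transpose_vec_mult_scalar[OF H u v] H u v by (simp add: comm_scalar_prod[where n = m])
  ultimately show ?thesis
    using H u v by (simp add: scalar_prod_add_distrib[where n = m])
qed

lemma qp_objective_symmetric_part:
  assumes H: "H \<in> carrier_mat m m" and q: "q \<in> carrier_vec m" and l: "l \<in> carrier_vec m"
  shows "qp_objective (1 / 2 \<cdot>\<^sub>m (H + H\<^sup>T)) q l = l \<bullet> (H *\<^sub>v l + q)"
  unfolding qp_objective_def symmetric_part_quadratic_form[OF H l l]
  using H q l by (simp add: scalar_prod_add_distrib[where n = m] comm_scalar_prod[of q m l])

lemma qp_objective_nonneg:
  assumes H: "H \<in> carrier_mat m m" and q: "q \<in> carrier_vec m" and l: "l \<in> qp_feasible m H q"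
  shows "0 \<le> l \<bullet> (H *\<^sub>v l + q)"
  using assms by (intro scalar_prod_nonneg_vec[where m = m]) (auto simp: qp_feasible_def)

text \<open>For the forward direction: if \<open>u\<close> is the multiplier vector of the constraint \<open>H l + q \<ge> 0\<close> at an
  optimum \<open>z\<close>, testing the KKT conditions against \<open>z\<close> and \<open>u\<close> gives
  \<open>z \<bullet> (H z + q) + (z - u) \<bullet> H (z - u) \<le> 0\<close>, in which both terms are nonnegative.\<close>

lemma qp_optimal_iff_lcp_solution:
  assumes H: "H \<in> carrier_mat m m" and q: "q \<in> carrier_vec m"
    and nn: "\<And>x. x \<in> carrier_vec m \<Longrightarrow> 0 \<le> x \<bullet> (H *\<^sub>v x)"
  shows "qp_optimal m (1 / 2 \<cdot>\<^sub>m (H + H\<^sup>T)) H q z \<longleftrightarrow> lcp_solution m H q z"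
proof
  assume z: "lcp_solution m H q z"
  have [simp]: "l \<in> qp_feasible m H q \<Longrightarrow> l \<in> carrier_vec m" for l by (simp add: qp_feasible_def)
  \<comment> \<open>The objective is at least 0 on the feasible set, and complementarity says that
    \<open>z\<close> attains 0.\<close>
  show "qp_optimal m (1 / 2 \<cdot>\<^sub>m (H + H\<^sup>T)) H q z"
    using z qp_objective_nonneg[OF H q] unfolding qp_optimal_def lcp_solution_def is_arg_min_def
    by (auto simp: qp_objective_symmetric_part[OF H q] not_less)
next
  let ?Hs = "1 / 2 \<cdot>\<^sub>m (H + H\<^sup>T)"
  assume opt: "qp_optimal m ?Hs H q z"
  then have zf: "z \<in> qp_feasible m H q"
    and zmin: "\<And>y. y \<in> qp_feasible m H q \<Longrightarrow> qp_objective ?Hs q z \<le> qp_objective ?Hs q y"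
    by (auto simp: qp_optimal_def is_arg_min_def not_less)
  have z: "z \<in> carrier_vec m" using zf by (simp add: qp_feasible_def)
  have Hs: "?Hs \<in> carrier_mat m m" using H by auto
  have HT: "H\<^sup>T \<in> carrier_mat m m" using H by auto
  \<comment> \<open>The gradient of the objective at \<open>z\<close>.\<close>
  define g where "g = H *\<^sub>v z + H\<^sup>T *\<^sub>v z + q"
  have g: "g \<in> carrier_vec m" using H z q by (simp add: g_def)
  have gd: "g \<bullet> d = d \<bullet> (H *\<^sub>v z) + z \<bullet> (H *\<^sub>v d) + q \<bullet> d" if d: "d \<in> carrier_vec m" for d
    using H z q d transpose_vec_mult_scalar[OF H d z] unfolding g_def
    by (simp add: add_scalar_prod_distrib[where n = m] comm_scalar_prod[of "H *\<^sub>v z" m d])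
  \<comment> \<open>Left summands index the rows of the constraint
    \<open>H *\<^sub>v y + q \<ge> 0\<close>, right summands those of \<open>y \<ge> 0\<close>; the
    minus signs bring both into the form \<open>a i \<bullet> y \<le> \<beta> i\<close>.\<close>
  define a where "a = case_sum (\<lambda>i. - row H i) (\<lambda>i. - unit_vec m i)"
  define \<beta> where "\<beta> = case_sum (\<lambda>i :: nat. q $ i) (\<lambda>i :: nat. 0)"
  define I where "I = {..<m} <+> {..<m}"
  have I: "finite I" "\<And>i. Inl i \<in> I \<longleftrightarrow> i < m" "\<And>i. Inr i \<in> I \<longleftrightarrow> i < m" by (auto simp: I_def)
  have feas: "y \<in> qp_feasible m H q \<longleftrightarrow> (\<forall>i\<in>I. a i \<bullet> y \<le> \<beta> i)" if y: "y \<in> carrier_vec m" for y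
  proof -
    have "(- (row H i \<bullet> y) \<le> q $ i) = (0 \<le> row H i \<bullet> y + q $ i)" for i by linarith
    then show ?thesis
      using H q y by (auto simp: qp_feasible_def less_eq_vec_def I_def a_def \<beta>_def ball_Un Plus_def)
  qed
  \<comment> \<open>First-order optimality: the segment from \<open>z\<close> to \<open>y\<close> is
    feasible, and a negative slope at \<open>z\<close> would lower the objective after a short
    step.\<close>
  have vi: "0 \<le> g \<bullet> (y - z)" if "y \<in> carrier_vec m" "y \<in> qp_feasible m H q" for y
  proof -
    define d where "d = y - z"
    have d: "d \<in> carrier_vec m" using that z by (simp add: d_def)
    have yd: "z + t \<cdot>\<^sub>v d = (1 - t) \<cdot>\<^sub>v z + t \<cdot>\<^sub>v y" for t
      using z that unfolding d_def by (intro eq_vecI) (auto simp: algebra_simps)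
    define s where "s = d \<bullet> (?Hs *\<^sub>v d)"
    have "0 \<le> s"
      using nn[OF d] unfolding s_def symmetric_part_quadratic_form[OF H d d] by simp
    have *: "0 \<le> g \<bullet> d + t * s" if "0 < t" "t \<le> 1" for t
    proof -
      have "z + t \<cdot>\<^sub>v d \<in> qp_feasible m H q"
        using convex_qp_feasible[OF H q] zf \<open>y \<in> qp_feasible m H q\<close> that unfolding convex_vecs_def yd by auto
      from zmin[OF this] have "0 \<le> t * (g \<bullet> d + t * s)"
        unfolding qp_objective_line[OF Hs q z d] symmetric_part_quadratic_form[OF H z d]
          symmetric_part_quadratic_form[OF H d z] gd[OF d] s_def
        by (simp add: algebra_simps power2_eq_square)
      then show ?thesis using that by (simp add: zero_le_mult_iff)
    qed
    show ?thesis
    proof (rule ccontr)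
      assume "\<not> 0 \<le> g \<bullet> (y - z)"
      then have neg: "g \<bullet> d < 0" by (simp add: d_def)
      \<comment> \<open>With this \<open>t\<close> the quadratic term is at most half of the linear
        decrease; \<open>s + 1\<close> keeps the denominator positive when
        \<open>s = 0\<close>.\<close>
      define t where "t = min 1 (- (g \<bullet> d) / (2 * (s + 1)))"
      have t: "0 < t" "t \<le> 1" using neg \<open>0 \<le> s\<close> by (auto simp: t_def intro!: divide_neg_pos)
      have "t \<le> - (g \<bullet> d) / (2 * (s + 1))" by (simp add: t_def)
      then have "t * (2 * (s + 1)) \<le> - (g \<bullet> d)" using \<open>0 \<le> s\<close> by (subst (asm) pos_le_divide_eq) auto
      moreover have "0 \<le> t * s" using t \<open>0 \<le> s\<close> by simp
      ultimately have "g \<bullet> d + t * s < 0" using t by (simp add: algebra_simps)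
      then show False using *[OF t] by simp
    qed
  qed
  obtain l where l: "\<And>i. i \<in> I - {} \<Longrightarrow> 0 \<le> l i"
    "\<And>i. i \<in> I \<Longrightarrow> l i * (a i \<bullet> z - \<beta> i) = 0"
    "\<And>d. d \<in> carrier_vec m \<Longrightarrow> g \<bullet> d + (\<Sum>i\<in>I. l i * (a i \<bullet> d)) = 0"
  proof (rule lagrange_multipliers[of I a m g z \<beta> "{}"])
    show "finite I" by fact
    show "a i \<in> carrier_vec m" if "i \<in> I" for i using that H by (auto simp: I_def a_def)
    show "a i \<bullet> z \<le> \<beta> i" if "i \<in> I" for i using feas[OF z] zf that by auto
    show "0 \<le> g \<bullet> (y - z)" if "y \<in> carrier_vec m" "\<And>i. i \<in> I \<Longrightarrow> a i \<bullet> y \<le> \<beta> i" for y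
      using vi[OF that(1)] feas[OF that(1)] that(2) by auto
  qed (use g z in auto)
  \<comment> \<open>\<open>u\<close> collects the multipliers of
    \<open>H *\<^sub>v y + q \<ge> 0\<close> and \<open>v\<close> those of
    \<open>y \<ge> 0\<close>.\<close>
  define u where "u = vec m (\<lambda>i. l (Inl i))"
  define v where "v = vec m (\<lambda>i. l (Inr i))"
  have uv: "u \<in> carrier_vec m" "v \<in> carrier_vec m" "0\<^sub>v m \<le> u" "0\<^sub>v m \<le> v"
    using l(1) by (auto simp: u_def v_def less_eq_vec_def I)
  have stat: "g \<bullet> d = u \<bullet> (H *\<^sub>v d) + v \<bullet> d" if d: "d \<in> carrier_vec m" for d
    using l(3)[OF d] d H unfolding I_def
    by (auto simp: sum.Plus a_def u_def v_def scalar_prod_def[of "vec m _"] sum_negf lessThan_atLeast0)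
  have "u $ i * ((H *\<^sub>v z + q) $ i) = 0" "v $ i * z $ i = 0" if "i < m" for i
    using l(2)[of "Inl i"] l(2)[of "Inr i"] that H z q
    by (auto simp: u_def v_def I a_def \<beta>_def algebra_simps)
  then have comp: "u \<bullet> (H *\<^sub>v z + q) = 0" "v \<bullet> z = 0"
    using H z q by (auto simp: scalar_prod_def[of u] scalar_prod_def[of v] simp del: index_mult_mat_vec
        intro!: sum.neutral)
  have car: "H *\<^sub>v z \<in> carrier_vec m" "H *\<^sub>v u \<in> carrier_vec m" using H z uv by auto
  have "0 \<le> (z - u) \<bullet> (H *\<^sub>v (z - u))" using nn z uv by auto
  also have "\<dots> = z \<bullet> (H *\<^sub>v z) - z \<bullet> (H *\<^sub>v u) - u \<bullet> (H *\<^sub>v z) + u \<bullet> (H *\<^sub>v u)"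
    using H z uv car by (simp add: mult_minus_distrib_mat_vec[where nr = m and nc = m]
        minus_scalar_prod_distrib[where n = m] scalar_prod_minus_distrib[where n = m])
  finally have 1: "0 \<le> z \<bullet> (H *\<^sub>v z) - z \<bullet> (H *\<^sub>v u) - u \<bullet> (H *\<^sub>v z) + u \<bullet> (H *\<^sub>v u)" .
  have 2: "z \<bullet> (H *\<^sub>v z) + z \<bullet> (H *\<^sub>v z) + q \<bullet> z = u \<bullet> (H *\<^sub>v z)"
    using stat[OF z] gd[OF z] comp by simp
  have 3: "u \<bullet> (H *\<^sub>v z) + z \<bullet> (H *\<^sub>v u) + q \<bullet> u = u \<bullet> (H *\<^sub>v u) + v \<bullet> u"
    using stat[OF uv(1)] gd[OF uv(1)] by simp
  have 4: "u \<bullet> (H *\<^sub>v z) + q \<bullet> u = 0"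
    using comp(1) car q uv by (simp add: scalar_prod_add_distrib[where n = m] comm_scalar_prod[of u m q])
  have 5: "0 \<le> v \<bullet> u" using uv by (intro scalar_prod_nonneg_vec)
  have 6: "z \<bullet> (H *\<^sub>v z + q) = z \<bullet> (H *\<^sub>v z) + q \<bullet> z"
    using car q z by (simp add: scalar_prod_add_distrib[where n = m] comm_scalar_prod[of z m q])
  \<comment> \<open>The equations combine to \<open>z \<bullet> (H *\<^sub>v z + q) + (z - u)
    \<bullet> (H *\<^sub>v (z - u)) = - (v \<bullet> u)\<close>.\<close>
  have "z \<bullet> (H *\<^sub>v z + q) \<le> 0" using 1 2 3 4 5 6 by linarith
  then show "lcp_solution m H q z"
    using qp_objective_nonneg[OF H q zf] zf by (simp add: lcp_solution_def)
qed

section \<open>Variational equilibria and the joint KKT conditions\<close>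

text \<open>Forward, \<open>lagrange_multipliers\<close> applies to the rows of \<open>A\<close> and
  \<open>E\<close>. Backward, pairing stationarity with \<open>y - x\<close> removes the equality
  term and, by complementarity, leaves \<open>l \<bullet> (b - A *\<^sub>v y)\<close>, which is
  nonnegative for feasible \<open>y\<close>.\<close>

lemma vGNE_iff_joint_KKT:
  assumes A: "A \<in> carrier_mat m n" and b: "b \<in> carrier_vec m"
    and E: "E \<in> carrier_mat q n" and e: "e \<in> carrier_vec q"
    and \<phi>: "\<And>x. x \<in> carrier_vec n \<Longrightarrow> \<phi> x \<in> carrier_vec n"
  shows "is_vGNE \<phi> (shared_set A b E e) x \<longleftrightarrow> (\<exists>l nu. joint_KKT \<phi> A b E e x l nu)"
proof
  assume v: "is_vGNE \<phi> (shared_set A b E e) x"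
  then have x: "x \<in> carrier_vec n" and Ax: "A *\<^sub>v x \<le> b" and Ex: "E *\<^sub>v x = e"
    using A by (auto simp: is_vGNE_def shared_set_def)
  \<comment> \<open>Left summands index inequalities, right summands equalities;
    \<open>range Inr\<close> serves as the set \<open>K\<close>, so the multipliers of
    \<open>E\<close> stay unsigned.\<close>
  define a where "a = case_sum (row A) (row E)"
  define \<beta> where "\<beta> = case_sum (($) b) (($) e)"
  define I where "I = {..<m} <+> {..<q}"
  have I: "finite I" "\<And>i. Inl i \<in> I \<longleftrightarrow> i < m" "\<And>i. Inr i \<in> I \<longleftrightarrow> i < q" by (auto simp: I_def)
  have mem: "y \<in> shared_set A b E e" if "y \<in> carrier_vec n" "\<And>i. i \<in> I \<Longrightarrow> a i \<bullet> y \<le> \<beta> i"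
    "\<And>i. i \<in> I \<Longrightarrow> i \<in> range Inr \<Longrightarrow> a i \<bullet> y = \<beta> i" for y
  proof -
    have "row A i \<bullet> y \<le> b $ i" if "i < m" for i
      using \<open>\<And>i. i \<in> I \<Longrightarrow> a i \<bullet> y \<le> \<beta> i\<close>[of "Inl i"] that by (simp add: I a_def \<beta>_def)
    moreover have "row E i \<bullet> y = e $ i" if "i < q" for i
      using \<open>\<And>i. i \<in> I \<Longrightarrow> i \<in> range Inr \<Longrightarrow> a i \<bullet> y = \<beta> i\<close>[of "Inr i"] that by (simp add: I a_def \<beta>_def)
    ultimately show ?thesis
      using \<open>y \<in> carrier_vec n\<close> A b E e by (auto simp: shared_set_def less_eq_vec_def intro!: eq_vecI)
  qed
  obtain l where l: "\<And>i. i \<in> I - range Inr \<Longrightarrow> 0 \<le> l i"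
    "\<And>i. i \<in> I \<Longrightarrow> l i * (a i \<bullet> x - \<beta> i) = 0"
    "\<And>d. d \<in> carrier_vec n \<Longrightarrow> \<phi> x \<bullet> d + (\<Sum>i\<in>I. l i * (a i \<bullet> d)) = 0"
  proof (rule lagrange_multipliers[of I a n "\<phi> x" x \<beta> "range Inr"])
    show "finite I" by fact
    show "a i \<in> carrier_vec n" if "i \<in> I" for i using that A E by (auto simp: I_def a_def)
    show "a i \<bullet> x \<le> \<beta> i" if "i \<in> I" for i
      using that Ax Ex A b E e by (auto simp: I_def a_def \<beta>_def less_eq_vec_def)
    show "a i \<bullet> x = \<beta> i" if "i \<in> I" "i \<in> range Inr" for i
      using that Ex E by (auto simp: I_def a_def \<beta>_def)
    show "0 \<le> \<phi> x \<bullet> (y - x)" if "y \<in> carrier_vec n" "\<And>i. i \<in> I \<Longrightarrow> a i \<bullet> y \<le> \<beta> i"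
      "\<And>i. i \<in> I \<Longrightarrow> i \<in> range Inr \<Longrightarrow> a i \<bullet> y = \<beta> i" for y
      using v mem[OF that] by (auto simp: is_vGNE_def)
  qed (use \<phi> x in auto)
  define u where "u = vec m (\<lambda>i. l (Inl i))"
  define w where "w = vec q (\<lambda>i. l (Inr i))"
  have uw: "u \<in> carrier_vec m" "w \<in> carrier_vec q" by (auto simp: u_def w_def)
  have stat: "\<phi> x \<bullet> d + u \<bullet> (A *\<^sub>v d) + w \<bullet> (E *\<^sub>v d) = 0" if d: "d \<in> carrier_vec n" for d
    using l(3)[OF d] d A E unfolding I_def
    by (auto simp: sum.Plus a_def u_def w_def scalar_prod_def[of "vec _ _"] lessThan_atLeast0 add.assoc)
  \<comment> \<open>Testing the weak form of stationarity on unit vectors recovers the vector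
    equation.\<close>
  have "\<phi> x + A\<^sup>T *\<^sub>v u + E\<^sup>T *\<^sub>v w = 0\<^sub>v n"
  proof (rule eq_vecI)
    fix i assume "i < dim_vec (0\<^sub>v n :: real vec)"
    then have i: "i < n" by simp
    let ?d = "unit_vec n i :: real vec"
    have d: "?d \<in> carrier_vec n" by simp
    have "(\<phi> x + A\<^sup>T *\<^sub>v u + E\<^sup>T *\<^sub>v w) $ i = (\<phi> x + A\<^sup>T *\<^sub>v u + E\<^sup>T *\<^sub>v w) \<bullet> ?d"
      using i \<phi>[OF x] A E uw by (subst scalar_prod_right_unit) auto
    also have "\<dots> = \<phi> x \<bullet> ?d + (A\<^sup>T *\<^sub>v u) \<bullet> ?d + (E\<^sup>T *\<^sub>v w) \<bullet> ?d"
      using i \<phi>[OF x] A E uw by (simp add: add_scalar_prod_distrib[where n = n] del: scalar_prod_right_unit)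
    also have "\<dots> = 0"
      using stat[OF d] transpose_vec_mult_scalar[OF A d uw(1)] transpose_vec_mult_scalar[OF E d uw(2)] by simp
    finally show "(\<phi> x + A\<^sup>T *\<^sub>v u + E\<^sup>T *\<^sub>v w) $ i = 0\<^sub>v n $ i" using i by simp
  qed (use \<phi>[OF x] A E uw in auto)
  moreover have "0 \<le> l (Inl i)" if "i < m" for i using that l(1)[of "Inl i"] by (auto simp: I)
  then have "0\<^sub>v m \<le> u" by (simp add: less_eq_vec_def u_def)
  moreover have "u $ i * ((A *\<^sub>v x - b) $ i) = 0" if "i < m" for i
    using l(2)[of "Inl i"] that A b by (auto simp: I a_def \<beta>_def u_def)
  then have "u \<bullet> (A *\<^sub>v x - b) = 0"
    using A b x by (auto simp: scalar_prod_def[of u] simp del: index_mult_mat_vec intro!: sum.neutral)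
  ultimately have "joint_KKT \<phi> A b E e x u w"
    using A E uw x Ax Ex by (simp add: joint_KKT_def)
  then show "\<exists>l nu. joint_KKT \<phi> A b E e x l nu" by blast
next
  assume "\<exists>l nu. joint_KKT \<phi> A b E e x l nu"
  then obtain l nu where x: "x \<in> carrier_vec n" and l: "l \<in> carrier_vec m" "0\<^sub>v m \<le> l"
    and nu: "nu \<in> carrier_vec q" and stat: "\<phi> x + A\<^sup>T *\<^sub>v l + E\<^sup>T *\<^sub>v nu = 0\<^sub>v n"
    and Ex: "E *\<^sub>v x = e" and Ax: "A *\<^sub>v x \<le> b" and comp: "l \<bullet> (A *\<^sub>v x - b) = 0"
    using A E by (auto simp: joint_KKT_def)
  have "0 \<le> \<phi> x \<bullet> (y - x)" if y: "y \<in> carrier_vec n" "A *\<^sub>v y \<le> b" "E *\<^sub>v y = e" for y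
  proof -
    have d: "y - x \<in> carrier_vec n" using x y by simp
    have "0 = (\<phi> x + A\<^sup>T *\<^sub>v l + E\<^sup>T *\<^sub>v nu) \<bullet> (y - x)" using d by (simp add: stat)
    also have "\<dots> = \<phi> x \<bullet> (y - x) + l \<bullet> (A *\<^sub>v (y - x)) + nu \<bullet> (E *\<^sub>v (y - x))"
      using \<phi>[OF x] A E l nu d transpose_vec_mult_scalar[OF A d l(1)] transpose_vec_mult_scalar[OF E d nu]
      by (simp add: add_scalar_prod_distrib[where n = n])
    also have "E *\<^sub>v (y - x) = 0\<^sub>v q"
      using E e x y(1,3) Ex by (simp add: mult_minus_distrib_mat_vec[where nr = q and nc = n])
    \<comment> \<open>Adding and subtracting the residual at \<open>x\<close> expresses the
      increment through the residuals at \<open>y\<close> and at \<open>x\<close>; complementarity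
      removes the latter.\<close>
    also have "A *\<^sub>v (y - x) = (A *\<^sub>v x - b) + A *\<^sub>v (y - x) - (A *\<^sub>v x - b)"
      using A b x y by (intro eq_vecI) auto
    also have "\<dots> = (A *\<^sub>v y - b) - (A *\<^sub>v x - b)"
      using A b x y by (subst mult_minus_distrib_mat_vec[where nr = m and nc = n])
        (auto intro!: eq_vecI simp del: index_mult_mat_vec)
    finally have "\<phi> x \<bullet> (y - x) = l \<bullet> (b - A *\<^sub>v y)"
      using A b x y l nu comp by (simp add: scalar_prod_minus_distrib[where n = m])
    also have "\<dots> \<ge> 0"
      using A b y l by (intro scalar_prod_nonneg_vec[where m = m]) (auto simp: less_eq_vec_def)
    finally show ?thesis .
  qed
  then show "is_vGNE \<phi> (shared_set A b E e) x"
    using A x Ax Ex by (auto simp: is_vGNE_def shared_set_def)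
qed

section \<open>Elimination of the primal variable and of the equality multipliers\<close>

lemma mult_mat_vec_uminus:
  fixes A :: "'a :: comm_ring_1 mat"
  assumes "A \<in> carrier_mat nr nc" "v \<in> carrier_vec nc"
  shows "A *\<^sub>v (- v) = - (A *\<^sub>v v)"
  using assms by (intro eq_vecI) auto

lemma add_eq_0_iff_vec:
  fixes u v :: "'a :: ab_group_add vec"
  assumes "u \<in> carrier_vec n" "v \<in> carrier_vec n"
  shows "u + v = 0\<^sub>v n \<longleftrightarrow> u = - v"
proof
  assume *: "u + v = 0\<^sub>v n"
  have "u $ i = - v $ i" if "i < n" for i
    using arg_cong[OF *, of "\<lambda>w. w $ i"] that assms by (simp add: eq_neg_iff_add_eq_0)
  then show "u = - v" using assms by (intro eq_vecI) auto
qed (use assms in auto)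

text \<open>Block elimination in the saddle-point system with blocks \<open>F\<close>,
  \<open>E\<^sup>T\<close>, \<open>E\<close> and 0: inverting \<open>F\<close> gives
  \<open>x\<close>, and substitution into \<open>E *\<^sub>v x = e\<close> leaves an equation for
  \<open>nu\<close> alone, whose matrix \<open>E * G * E\<^sup>T\<close> is the Schur complement up
  to sign. Every step is reversible.\<close>

lemma saddle_point_system_iff:
  fixes F G E W :: "'a :: field mat"
  assumes F: "F \<in> carrier_mat n n" and G: "G \<in> carrier_mat n n"
    and FG: "F * G = 1\<^sub>m n" and GF: "G * F = 1\<^sub>m n"
    and E: "E \<in> carrier_mat q n" and W: "W \<in> carrier_mat q q"
    and MW: "E * G * E\<^sup>T * W = 1\<^sub>m q" and WM: "W * (E * G * E\<^sup>T) = 1\<^sub>m q"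
    and h: "h \<in> carrier_vec n" and e: "e \<in> carrier_vec q"
    and x: "x \<in> carrier_vec n" and nu: "nu \<in> carrier_vec q"
  shows "F *\<^sub>v x + h + E\<^sup>T *\<^sub>v nu = 0\<^sub>v n \<and> E *\<^sub>v x = e \<longleftrightarrow>
    nu = - (W *\<^sub>v ((E * G) *\<^sub>v h + e)) \<and> x = - (G *\<^sub>v (h + E\<^sup>T *\<^sub>v nu))"
proof -
  define M where "M = E * G * E\<^sup>T"
  define r where "r = h + E\<^sup>T *\<^sub>v nu"
  define s where "s = (E * G) *\<^sub>v h + e"
  have ET: "E\<^sup>T \<in> carrier_mat n q" and EG: "E * G \<in> carrier_mat q n" and M: "M \<in> carrier_mat q q"
    using E G by (auto simp: M_def)
  have r: "r \<in> carrier_vec n" and s: "s \<in> carrier_vec q" using h ET nu EG e by (auto simp: r_def s_def)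
  have stat: "F *\<^sub>v x + h + E\<^sup>T *\<^sub>v nu = 0\<^sub>v n \<longleftrightarrow> x = - (G *\<^sub>v r)"
  proof -
    have "F *\<^sub>v x + h + E\<^sup>T *\<^sub>v nu = F *\<^sub>v x + r"
      using F x h ET nu by (auto simp: r_def assoc_add_vec[where n = n])
    moreover have "F *\<^sub>v x + r = 0\<^sub>v n \<longleftrightarrow> F *\<^sub>v x = - r"
      using F x r by (intro add_eq_0_iff_vec) auto
    moreover have "F *\<^sub>v x = - r \<longleftrightarrow> x = - (G *\<^sub>v r)"
    proof
      assume "F *\<^sub>v x = - r"
      then have "(G * F) *\<^sub>v x = - (G *\<^sub>v r)"
        using assoc_mult_mat_vec[OF G F x] mult_mat_vec_uminus[OF G r] by simp
      then show "x = - (G *\<^sub>v r)" using x by (simp add: GF)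
    next
      assume "x = - (G *\<^sub>v r)"
      then have "F *\<^sub>v x = - ((F * G) *\<^sub>v r)"
        using assoc_mult_mat_vec[OF F G r] mult_mat_vec_uminus[of F n n "G *\<^sub>v r"] F G r by simp
      then show "F *\<^sub>v x = - r" using r by (simp add: FG)
    qed
    ultimately show ?thesis by simp
  qed
  have "E *\<^sub>v x = e \<longleftrightarrow> nu = - (W *\<^sub>v s)" if "x = - (G *\<^sub>v r)"
  proof -
    have "E *\<^sub>v x = - ((E * G) *\<^sub>v r)"
      using assoc_mult_mat_vec[OF E G r] mult_mat_vec_uminus[of E q n "G *\<^sub>v r"] E G r that by simp
    also have "(E * G) *\<^sub>v r = (E * G) *\<^sub>v h + M *\<^sub>v nu"
      using mult_add_distrib_mat_vec[OF EG h, of "E\<^sup>T *\<^sub>v nu"] assoc_mult_mat_vec[OF EG ET nu] ET nu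
      by (simp add: r_def M_def)
    finally have "E *\<^sub>v x = - ((E * G) *\<^sub>v h + M *\<^sub>v nu)" .
    then have "E *\<^sub>v x = e \<longleftrightarrow> e = - ((E * G) *\<^sub>v h + M *\<^sub>v nu)" by auto
    also have "\<dots> \<longleftrightarrow> e + ((E * G) *\<^sub>v h + M *\<^sub>v nu) = 0\<^sub>v q"
      using e EG h M nu by (intro add_eq_0_iff_vec[symmetric]) auto
    also have "e + ((E * G) *\<^sub>v h + M *\<^sub>v nu) = M *\<^sub>v nu + s"
      unfolding s_def using e EG h M nu by (intro eq_vecI) (auto simp del: index_mult_mat_vec simp: algebra_simps)
    also have "M *\<^sub>v nu + s = 0\<^sub>v q \<longleftrightarrow> M *\<^sub>v nu = - s"
      using M nu s by (intro add_eq_0_iff_vec) auto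
    also have "\<dots> \<longleftrightarrow> nu = - (W *\<^sub>v s)"
    proof
      assume "M *\<^sub>v nu = - s"
      then have "(W * M) *\<^sub>v nu = - (W *\<^sub>v s)"
        using assoc_mult_mat_vec[OF W M nu] mult_mat_vec_uminus[OF W s] by simp
      then show "nu = - (W *\<^sub>v s)" using nu WM by (simp add: M_def)
    next
      assume "nu = - (W *\<^sub>v s)"
      then have "M *\<^sub>v nu = - ((M * W) *\<^sub>v s)"
        using assoc_mult_mat_vec[OF M W s] mult_mat_vec_uminus[of M q q "W *\<^sub>v s"] M W s by simp
      then show "M *\<^sub>v nu = - s" using s MW by (simp add: M_def)
    qed
    finally show ?thesis .
  qed
  then show ?thesis using stat by (auto simp: r_def s_def)
qed

section \<open>The constrained inverse \<open>P\<close> and its quadratic form\<close>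

lemma assoc_mult3_mat_vec:
  fixes A B C :: "'a :: semiring_0 mat"
  assumes A: "A \<in> carrier_mat n1 n2" and B: "B \<in> carrier_mat n2 n3" and C: "C \<in> carrier_mat n3 n4"
    and v: "v \<in> carrier_vec n4"
  shows "(A * B * C) *\<^sub>v v = A *\<^sub>v (B *\<^sub>v (C *\<^sub>v v))"
  using assoc_mult_mat_vec[OF mult_carrier_mat[OF A B] C v] assoc_mult_mat_vec[OF A B, of "C *\<^sub>v v"] C v
  by simp

text \<open>This bracketing keeps the factor \<open>G * E\<^sup>T * W\<close> intact, which also
  multiplies \<open>e\<close> in the primal solution.\<close>

lemma constrained_inverse_mult_vec:
  fixes G E W :: "'a :: field mat"
  assumes G: "G \<in> carrier_mat n n" and E: "E \<in> carrier_mat q n" and W: "W \<in> carrier_mat q q"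
    and w: "w \<in> carrier_vec n"
  shows "(G - G * E\<^sup>T * W * E * G) *\<^sub>v w = G *\<^sub>v w - (G * E\<^sup>T * W) *\<^sub>v (E *\<^sub>v (G *\<^sub>v w))"
proof -
  have ET: "E\<^sup>T \<in> carrier_mat n q" using E by simp
  have K: "G * E\<^sup>T * W \<in> carrier_mat n q" using G ET W by simp
  have KE: "G * E\<^sup>T * W * E \<in> carrier_mat n n" using K E by simp
  have "(G * E\<^sup>T * W * E * G) *\<^sub>v w = (G * E\<^sup>T * W) *\<^sub>v (E *\<^sub>v (G *\<^sub>v w))"
    using assoc_mult_mat_vec[OF KE G w] assoc_mult_mat_vec[OF K E, of "G *\<^sub>v w"] G w by simp
  then show ?thesis
    using minus_mult_distrib_mat_vec[OF G mult_carrier_mat[OF KE G] w] by simp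
qed

text \<open>Inserting the equality multiplier into the formula for \<open>x\<close> separates the
  contributions of \<open>h\<close> and \<open>e\<close>. When \<open>G\<close> and \<open>W\<close>
  invert \<open>F\<close> and \<open>E * G * E\<^sup>T\<close>, the two matrices on the right are
  the upper blocks of the inverse of the saddle-point matrix.\<close>

lemma saddle_point_primal_solution:
  fixes G E W :: "'a :: field mat"
  assumes G: "G \<in> carrier_mat n n" and E: "E \<in> carrier_mat q n" and W: "W \<in> carrier_mat q q"
    and h: "h \<in> carrier_vec n" and e: "e \<in> carrier_vec q"
  shows "- (G *\<^sub>v (h + E\<^sup>T *\<^sub>v (- (W *\<^sub>v ((E * G) *\<^sub>v h + e))))) =
    - ((G - G * E\<^sup>T * W * E * G) *\<^sub>v h) + (G * E\<^sup>T * W) *\<^sub>v e"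
proof -
  define K where "K = G * E\<^sup>T * W"
  define s where "s = E *\<^sub>v (G *\<^sub>v h)"
  have ET: "E\<^sup>T \<in> carrier_mat n q" and K: "K \<in> carrier_mat n q" using G E W by (auto simp: K_def)
  have Gh: "G *\<^sub>v h \<in> carrier_vec n" and s: "s \<in> carrier_vec q" using G E h by (auto simp: s_def)
  have EGh: "(E * G) *\<^sub>v h = s" using assoc_mult_mat_vec[OF E G h] by (simp add: s_def)
  have Ws: "W *\<^sub>v (s + e) \<in> carrier_vec q" using W s e by auto
  have "G *\<^sub>v (h + E\<^sup>T *\<^sub>v (- (W *\<^sub>v (s + e)))) = G *\<^sub>v h + - (K *\<^sub>v (s + e))"
    using mult_mat_vec_uminus[OF ET Ws] mult_add_distrib_mat_vec[OF G h, of "- (E\<^sup>T *\<^sub>v (W *\<^sub>v (s + e)))"]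
      mult_mat_vec_uminus[OF G, of "E\<^sup>T *\<^sub>v (W *\<^sub>v (s + e))"] ET Ws s e
      assoc_mult3_mat_vec[OF G ET W, of "s + e"]
    by (simp add: K_def)
  also have "K *\<^sub>v (s + e) = K *\<^sub>v s + K *\<^sub>v e"
    by (rule mult_add_distrib_mat_vec[OF K s e])
  finally have "- (G *\<^sub>v (h + E\<^sup>T *\<^sub>v (- (W *\<^sub>v (s + e))))) = - (G *\<^sub>v h - K *\<^sub>v s) + K *\<^sub>v e"
    using G K by (simp only:) (auto intro!: eq_vecI simp del: index_mult_mat_vec)
  then show ?thesis
    unfolding EGh constrained_inverse_mult_vec[OF G E W h] by (simp only: K_def s_def)
qed

text \<open>\<open>P w\<close> lies in the kernel of \<open>E\<close>, and \<open>F (P w)\<close> differs from \<open>w\<close> by an element of the range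
  of \<open>E\<^sup>T\<close>, so that \<open>w \<bullet> P w = P w \<bullet> F (P w)\<close>.\<close>

lemma constrained_inverse_nonneg:
  fixes F G E W :: "'a :: linordered_field mat"
  assumes F: "F \<in> carrier_mat n n" and G: "G \<in> carrier_mat n n" and FG: "F * G = 1\<^sub>m n"
    and E: "E \<in> carrier_mat q n" and W: "W \<in> carrier_mat q q" and MW: "E * G * E\<^sup>T * W = 1\<^sub>m q"
    and F_nonneg: "\<And>y. y \<in> carrier_vec n \<Longrightarrow> 0 \<le> y \<bullet> (F *\<^sub>v y)"
    and w: "w \<in> carrier_vec n"
  shows "0 \<le> w \<bullet> ((G - G * E\<^sup>T * W * E * G) *\<^sub>v w)"
proof -
  define y where "y = (G - G * E\<^sup>T * W * E * G) *\<^sub>v w"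
  define s where "s = W *\<^sub>v (E *\<^sub>v (G *\<^sub>v w))"
  have ET: "E\<^sup>T \<in> carrier_mat n q" using E by simp
  have Gw: "G *\<^sub>v w \<in> carrier_vec n" and EGw: "E *\<^sub>v (G *\<^sub>v w) \<in> carrier_vec q" and s: "s \<in> carrier_vec q"
    using G E W w by (auto simp: s_def)
  have t: "E\<^sup>T *\<^sub>v s \<in> carrier_vec n" using ET s by simp
  have y_eq: "y = G *\<^sub>v (w - E\<^sup>T *\<^sub>v s)"
    using constrained_inverse_mult_vec[OF G E W w] assoc_mult3_mat_vec[OF G ET W EGw] mult_minus_distrib_mat_vec[OF G w t]
    by (simp add: y_def s_def)
  then have y: "y \<in> carrier_vec n" using G w t by auto
  have "F *\<^sub>v y = w - E\<^sup>T *\<^sub>v s"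
    using assoc_mult_mat_vec[OF F G, of "w - E\<^sup>T *\<^sub>v s"] w t by (simp add: y_eq FG)
  then have w_eq: "w = F *\<^sub>v y + E\<^sup>T *\<^sub>v s" using w t E by (intro eq_vecI) auto
  \<comment> \<open>The two terms cancel because \<open>W\<close> is a right inverse of
    \<open>E * G * E\<^sup>T\<close>.\<close>
  have "E *\<^sub>v y = E *\<^sub>v (G *\<^sub>v w) - (E * G) *\<^sub>v (E\<^sup>T *\<^sub>v s)"
    using mult_minus_distrib_mat_vec[OF G w t] mult_minus_distrib_mat_vec[OF E Gw, of "G *\<^sub>v (E\<^sup>T *\<^sub>v s)"]
      assoc_mult_mat_vec[OF E G t] G t by (simp add: y_eq)
  also have "(E * G) *\<^sub>v (E\<^sup>T *\<^sub>v s) = (E * G * E\<^sup>T * W) *\<^sub>v (E *\<^sub>v (G *\<^sub>v w))"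
    using assoc_mult_mat_vec[OF mult_carrier_mat[OF E G] ET s]
      assoc_mult_mat_vec[OF mult_carrier_mat[OF mult_carrier_mat[OF E G] ET] W EGw] by (simp add: s_def)
  finally have Ey: "E *\<^sub>v y = 0\<^sub>v q" using EGw by (simp add: MW)
  have "w \<bullet> y = (F *\<^sub>v y) \<bullet> y + s \<bullet> (E *\<^sub>v y)"
    using F y t transpose_vec_mult_scalar[OF E y s]
    by (subst w_eq) (simp add: add_scalar_prod_distrib[where n = n])
  also have "\<dots> = y \<bullet> (F *\<^sub>v y)"
    using F y s by (simp add: Ey comm_scalar_prod[of "F *\<^sub>v y" n y])
  finally show ?thesis using F_nonneg[OF y] by (simp add: y_def)
qed

section \<open>Reduction of the game to the quadratic program\<close>

text \<open>Equality of solution sets also transfers solvability: the game has an equilibrium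
  exactly when the program has a minimizer, and each minimizer belongs to exactly one joint KKT
  triple.\<close>

theorem lemma5p1:
  fixes N n m q :: nat and nd :: "nat \<Rightarrow> nat"
    and Q :: "nat \<Rightarrow> real mat" and c :: "nat \<Rightarrow> real vec"
    and A E F M G P H Hs :: "real mat" and b e f x0 q0 :: "real vec"
    and \<phi> :: "real vec \<Rightarrow> real vec" and X :: "real vec set"
    and x_of nu_of :: "real vec \<Rightarrow> real vec"
  assumes n: "n = game_dim N nd"
    and Q: "\<And>i. i < N \<Longrightarrow> Q i \<in> carrier_mat n n" "\<And>i. i < N \<Longrightarrow> (Q i)\<^sup>T = Q i"
    and c: "\<And>i. i < N \<Longrightarrow> c i \<in> carrier_vec n"
    and A: "A \<in> carrier_mat m n" and b: "b \<in> carrier_vec m"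
    and E: "E \<in> carrier_mat q n" and e: "e \<in> carrier_vec q"
    and X: "X = shared_set A b E e"
    and \<phi>: "\<phi> = pseudogradient N nd Q c"
    and F: "F = pseudogradient_mat N nd Q" and f: "f = pseudogradient_vec N nd c"
    and G: "G = mat_inv F"
    and M: "M = E * G * E\<^sup>T"
    and P: "P = G - G * E\<^sup>T * mat_inv M * E * G"
    and H: "H = A * P * A\<^sup>T" and Hs: "Hs = (1 / 2) \<cdot>\<^sub>m (H + H\<^sup>T)"
    and x0: "x0 = - (P *\<^sub>v f) + (G * E\<^sup>T * mat_inv M) *\<^sub>v e"
    and q0: "q0 = b - A *\<^sub>v x0"
    and x_of: "\<And>l. x_of l = x0 - (P * A\<^sup>T) *\<^sub>v l"
    and nu_of: "\<And>l. nu_of l = - (mat_inv M *\<^sub>v ((E * G) *\<^sub>v (f + A\<^sup>T *\<^sub>v l) + e))"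
    and F_psd: "psd n (F + F\<^sup>T)"
    and F_inv: "invertible_mat F"
    and rank_E: "q > 0 \<Longrightarrow> vec_space.rank q E = q"
    and M_inv: "q > 0 \<Longrightarrow> invertible_mat M"
  shows "psd m Hs \<and> convex_on_vecs (carrier_vec m) (qp_objective Hs q0) \<and>
      convex_vecs (qp_feasible m H q0) \<and>
      {x. is_vGNE \<phi> X x} = x_of ` {l. qp_optimal m Hs H q0 l} \<and>
      {(x, l, nu). joint_KKT \<phi> A b E e x l nu} =
        {(x_of l, l, nu_of l) | l. qp_optimal m Hs H q0 l}"
proof -
  define W where "W = mat_inv M"
  have Fc: "F \<in> carrier_mat n n" and fc: "f \<in> carrier_vec n"
    by (simp_all add: F f n pseudogradient_mat_def pseudogradient_vec_def)
  note Gc = mat_inv(1)[OF Fc F_inv, folded G] and FG = mat_inv(2)[OF Fc F_inv, folded G]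
    and GF = mat_inv(3)[OF Fc F_inv, folded G]
  have AT: "A\<^sup>T \<in> carrier_mat n m" using A by simp
  have Mc: "M \<in> carrier_mat q q" using E Gc by (simp add: M)
  \<comment> \<open>For \<open>q = 0\<close> the matrix \<open>M\<close> is empty and its own
    inverse, so both cases continue uniformly.\<close>
  have "invertible_mat M"
  proof (cases "q = 0")
    case True
    then have "M * M = 1\<^sub>m q" using Mc by (intro eq_matI) auto
    then show ?thesis
      using Mc unfolding invertible_mat_def inverts_mat_def by auto
  qed (use M_inv in simp)
  note W = mat_inv(1)[OF Mc this, folded W_def] and MW = mat_inv(2)[OF Mc this, folded W_def]
    and WM = mat_inv(3)[OF Mc this, folded W_def]
  have Pc: "P \<in> carrier_mat n n" unfolding P W_def[symmetric] using Gc E W by (intro carrier_matI) auto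
  have Hc: "H \<in> carrier_mat m m" using A Pc by (simp add: H)
  have x0c: "x0 \<in> carrier_vec n"
    unfolding x0 W_def[symmetric] using Pc fc Gc E W e by (intro carrier_vecI) auto
  have q0c: "q0 \<in> carrier_vec m" using A b x0c by (simp add: q0)
  have F_nonneg: "0 \<le> y \<bullet> (F *\<^sub>v y)" if y: "y \<in> carrier_vec n" for y
  proof -
    have "0 \<le> y \<bullet> ((F + F\<^sup>T) *\<^sub>v y)" using F_psd y by (simp add: psd_def)
    also have "(F + F\<^sup>T) *\<^sub>v y = F *\<^sub>v y + F\<^sup>T *\<^sub>v y"
      using Fc y by (intro add_mult_distrib_mat_vec) auto
    also have "y \<bullet> (F *\<^sub>v y + F\<^sup>T *\<^sub>v y) = y \<bullet> (F *\<^sub>v y) + y \<bullet> (F\<^sup>T *\<^sub>v y)"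
      using Fc y by (intro scalar_prod_add_distrib[where n = n]) auto
    also have "y \<bullet> (F\<^sup>T *\<^sub>v y) = y \<bullet> (F *\<^sub>v y)"
      using transpose_vec_mult_scalar[OF Fc y y] Fc y by (simp add: comm_scalar_prod[of y n])
    finally show ?thesis by simp
  qed
  have H_mult: "H *\<^sub>v l = A *\<^sub>v (P *\<^sub>v (A\<^sup>T *\<^sub>v l))" and PAT_mult: "(P * A\<^sup>T) *\<^sub>v l = P *\<^sub>v (A\<^sup>T *\<^sub>v l)"
    if l: "l \<in> carrier_vec m" for l
    using assoc_mult_mat_vec[OF mult_carrier_mat[OF A Pc] AT l] assoc_mult_mat_vec[OF A Pc, of "A\<^sup>T *\<^sub>v l"]
      assoc_mult_mat_vec[OF Pc AT l] AT l by (simp_all add: H)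
  \<comment> \<open>\<open>H\<close> is a congruence of \<open>P\<close>: its form at
    \<open>l\<close> is that of \<open>P\<close> at \<open>A\<^sup>T *\<^sub>v l\<close>.\<close>
  have H_nonneg: "0 \<le> l \<bullet> (H *\<^sub>v l)" if l: "l \<in> carrier_vec m" for l
  proof -
    have w: "A\<^sup>T *\<^sub>v l \<in> carrier_vec n" using AT l by simp
    have "0 \<le> (A\<^sup>T *\<^sub>v l) \<bullet> (P *\<^sub>v (A\<^sup>T *\<^sub>v l))"
      using constrained_inverse_nonneg[OF Fc Gc FG E W _ F_nonneg w] MW by (simp add: P W_def M)
    also have "\<dots> = l \<bullet> (H *\<^sub>v l)"
      using transpose_vec_mult_scalar[OF A _ l, of "P *\<^sub>v (A\<^sup>T *\<^sub>v l)"] Pc w by (simp add: H_mult[OF l])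
    finally show ?thesis .
  qed
  have Hs_psd: "psd m Hs"
    unfolding psd_def
  proof (intro conjI ballI)
    show "Hs \<in> carrier_mat m m" using Hc by (simp add: Hs)
    show "Hs\<^sup>T = Hs" using Hc unfolding Hs by (intro eq_matI) auto
    show "0 \<le> l \<bullet> (Hs *\<^sub>v l)" if "l \<in> carrier_vec m" for l
      unfolding Hs symmetric_part_quadratic_form[OF Hc that that] using H_nonneg[OF that] by simp
  qed
  have opt: "qp_optimal m Hs H q0 l \<longleftrightarrow> lcp_solution m H q0 l" for l
    unfolding Hs by (rule qp_optimal_iff_lcp_solution[OF Hc q0c H_nonneg])
  have \<phi>_eq: "\<phi> x = F *\<^sub>v x + f" if "x \<in> carrier_vec n" for x
    unfolding \<phi> F f using Q c that by (intro pseudogradient_affine) (simp_all add: n)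
  have \<phi>_carrier: "\<phi> x \<in> carrier_vec n" if "x \<in> carrier_vec n" for x
    using \<phi>_eq[OF that] Fc fc that by simp
  have x_of_carrier: "x_of l \<in> carrier_vec n" if "l \<in> carrier_vec m" for l
    using that x0c Pc AT by (simp add: x_of)
  have nu_of_carrier: "nu_of l \<in> carrier_vec q" if "l \<in> carrier_vec m" for l
    using that W E Gc AT fc e by (simp add: nu_of W_def[symmetric])
  \<comment> \<open>The residual of the complementarity problem is the slack of the shared
    inequalities, which turns primal feasibility into a constraint on \<open>l\<close>.\<close>
  have slack: "b - A *\<^sub>v x_of l = H *\<^sub>v l + q0" if l: "l \<in> carrier_vec m" for l
  proof -
    have w: "P *\<^sub>v (A\<^sup>T *\<^sub>v l) \<in> carrier_vec n" using Pc AT l by auto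
    show ?thesis
      unfolding x_of PAT_mult[OF l] H_mult[OF l] q0 mult_minus_distrib_mat_vec[OF A x0c w]
      using A b by (intro eq_vecI) (auto simp del: index_mult_mat_vec)
  qed
  have system: "\<phi> x + A\<^sup>T *\<^sub>v l + E\<^sup>T *\<^sub>v nu = 0\<^sub>v n \<and> E *\<^sub>v x = e \<longleftrightarrow> nu = nu_of l \<and> x = x_of l"
    if x: "x \<in> carrier_vec n" and l: "l \<in> carrier_vec m" and nu: "nu \<in> carrier_vec q" for x l nu
  proof -
    define h where "h = f + A\<^sup>T *\<^sub>v l"
    have w: "A\<^sup>T *\<^sub>v l \<in> carrier_vec n" and h: "h \<in> carrier_vec n" using AT l fc by (auto simp: h_def)
    have Ke: "(G * E\<^sup>T * W) *\<^sub>v e \<in> carrier_vec n" using Gc E W e by (intro carrier_vecI) auto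
    have "\<phi> x + A\<^sup>T *\<^sub>v l = F *\<^sub>v x + h"
      using Fc x fc w by (simp add: \<phi>_eq h_def assoc_add_vec[where n = n])
    moreover have "nu_of l = - (W *\<^sub>v ((E * G) *\<^sub>v h + e))"
      by (simp add: nu_of h_def W_def)
    \<comment> \<open>Linearity of \<open>P\<close> merges \<open>f\<close> and the inequality
      multipliers into \<open>h\<close>.\<close>
    moreover have "x_of l = - (P *\<^sub>v h) + (G * E\<^sup>T * W) *\<^sub>v e"
      unfolding x_of PAT_mult[OF l] x0 h_def mult_add_distrib_mat_vec[OF Pc fc w] W_def[symmetric]
      using Pc Gc fc w Ke by (intro eq_vecI) (auto simp del: index_mult_mat_vec)
    then have "x_of l = - (G *\<^sub>v (h + E\<^sup>T *\<^sub>v (- (W *\<^sub>v ((E * G) *\<^sub>v h + e)))))"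
      using saddle_point_primal_solution[OF Gc E W h e] by (simp add: P W_def)
    ultimately show ?thesis
      using saddle_point_system_iff[OF Fc Gc FG GF E W _ _ h e x nu] MW WM M by auto
  qed
  have KKT: "joint_KKT \<phi> A b E e x l nu \<longleftrightarrow> qp_optimal m Hs H q0 l \<and> x = x_of l \<and> nu = nu_of l" for x l nu
  proof -
    have comp: "A *\<^sub>v x_of l \<le> b \<and> 0\<^sub>v m \<le> l \<and> l \<bullet> (A *\<^sub>v x_of l - b) = 0 \<longleftrightarrow> lcp_solution m H q0 l"
      if l: "l \<in> carrier_vec m" for l
    proof -
      have Ax: "A *\<^sub>v x_of l \<in> carrier_vec m" using A x_of_carrier[OF l] by simp
      have "A *\<^sub>v x_of l \<le> b \<longleftrightarrow> 0\<^sub>v m \<le> b - A *\<^sub>v x_of l"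
        using Ax b by (auto simp: less_eq_vec_def simp del: index_mult_mat_vec)
      moreover have "l \<bullet> (A *\<^sub>v x_of l - b) = - (l \<bullet> (b - A *\<^sub>v x_of l))"
        using l Ax b by (simp add: scalar_prod_minus_distrib[where n = m])
      ultimately show ?thesis
        using l unfolding slack[OF l] by (auto simp: lcp_solution_def qp_feasible_def)
    qed
    have lc: "l \<in> carrier_vec m" if "lcp_solution m H q0 l" for l
      using that by (simp add: lcp_solution_def qp_feasible_def)
    \<comment> \<open>Stationarity and the equality constraint fix \<open>x\<close> and
      \<open>nu\<close>; the other conditions, read at \<open>x_of l\<close>, form the
      complementarity problem.\<close>
    have "joint_KKT \<phi> A b E e x l nu \<longleftrightarrow>
        x \<in> carrier_vec n \<and> l \<in> carrier_vec m \<and> nu \<in> carrier_vec q \<and> nu = nu_of l \<and> x = x_of l \<and>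
        A *\<^sub>v x \<le> b \<and> 0\<^sub>v m \<le> l \<and> l \<bullet> (A *\<^sub>v x - b) = 0"
      using A E system[of x l nu] by (auto simp: joint_KKT_def)
    also have "\<dots> \<longleftrightarrow> lcp_solution m H q0 l \<and> x = x_of l \<and> nu = nu_of l"
      using comp lc x_of_carrier nu_of_carrier by blast
    finally show ?thesis by (simp add: opt)
  qed
  have vGNE: "is_vGNE \<phi> X x \<longleftrightarrow> (\<exists>l nu. joint_KKT \<phi> A b E e x l nu)" for x
    unfolding X by (rule vGNE_iff_joint_KKT[OF A b E e \<phi>_carrier])
  show ?thesis
    using Hs_psd convex_on_qp_objective[OF Hs_psd q0c] convex_qp_feasible[OF Hc q0c]
    by (auto simp: vGNE KKT)
qed

end
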